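(* Let $D\ge1$ and $0\le d\le D$. Let $G=G_1\,\Box\,\cdots\,\Box\,G_D$ be a cartesian product in which exactly $d$ factors are cycle digraphs $C_{n_\mu}$ with $n_\mu$ even, and the remaining $D-d$ factors are simple directed paths $P_{n_\mu}$ with $n_\mu$ odd. Then $$|V|\cdot r-\operatorname{rank}\mathcal D(G)=r\cdot\prod_{\mu=1}^D\big(\beta_0(G_\mu)+\beta_1(G_\mu)\big)=r\cdot 2^d,$$ where $|V|=\prod_\mu n_\mu$. Equivalently, $\dim\ker\mathcal D(G)/r=2^d$.
   Context: The cycle digraph $C_n$ ($n\ge3$) has vertex set $\{1,\dots,n\}$ and edges $i\to i+1$ for $1\le i\le n-1$ together with $n\to1$. The simple directed path $P_n$ ($n\ge2$) has vertex set $\{1,\dots,n\}$ and edges $i\to i+1$ for $1\le i\le n-1$. For a directed graph without multiple edges, the anti-symmetrized adjacency matrix $A_{\mathrm{as}}$ is the $|V|\times|V|$ matrix with: - $(A_{\mathrm{as}})_{ij}=1$ if an edge leaves $i$ and enters $j$; - $(A_{\mathrm{as}})_{ij}=-1$ if an edge leaves $j$ and enters $i$; - $(A_{\mathrm{as}})_{ij}=0$ otherwise. Let $\gamma_1,\dots,\gamma_D$ be complex $r\times r$ matrices satisfying $\gamma_\mu\gamma_\nu+\gamma_\nu\gamma_\mu=2\delta_{\mu\nu}\mathbf 1_r$. In particular each $\gamma_\mu$ is invertible, and $r=\operatorname{rank}\gamma$. For $G=G_1\Box\cdots\Box G_D$ with $G_\mu$ having $n_\mu$ vertices, define the $(r\prod_\mu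 n_\mu)$-square matrix $$\mathcal D(G)=\sum_{\mu=1}^D\Big(\mathbf 1_{n_D}\otimes\cdots\otimes\mathbf 1_{n_{\mu+1}}\otimes A_{\mathrm{as}}(G_\mu)\otimes\mathbf 1_{n_{\mu-1}}\otimes\cdots\otimes\mathbf 1_{n_1}\Big)\otimes\gamma_\mu,$$ where $\otimes$ is the Kronecker product and $\mathbf 1_k$ is the $k\times k$ identity. Betti numbers of a factor graph: $\beta_0$ is the number of connected components and $\beta_1=|E|-|V|+\beta_0$. Thus $\beta_0+\beta_1$ equals $2$ for a cycle and $1$ for a path. *)

theory Defs
  imports Complex_Main "Jordan_Normal_Form.DL_Rank"
begin

text \<open>A (finite) digraph without multiple edges on vertex set {1..n}, given by its
number of vertices and its edge set (pairs (tail, head)).\<close>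
type_synonym digraph = "nat \<times> (nat \<times> nat) set"

definition nverts :: "digraph \<Rightarrow> nat" where "nverts G = fst G"
definition edges :: "digraph \<Rightarrow> (nat \<times> nat) set" where "edges G = snd G"

definition cycle_digraph :: "nat \<Rightarrow> digraph" where
  "cycle_digraph n = (n, {(i, i + 1) | i. 1 \<le> i \<and> i \<le> n - 1} \<union> {(n, 1)})"

definition path_digraph :: "nat \<Rightarrow> digraph" where
  "path_digraph n = (n, {(i, i + 1) | i. 1 \<le> i \<and> i \<le> n - 1})"

definition conn_rel :: "digraph \<Rightarrow> (nat \<times> nat) set" where
  "conn_rel G = (edges G \<union> (edges G)\<inverse>)\<^sup>*"

definition beta0 :: "digraph \<Rightarrow> nat" where
  "beta0 G = card ({1..nverts G} // conn_rel G)"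

definition beta1 :: "digraph \<Rightarrow> int" where
  "beta1 G = int (card (edges G)) - int (nverts G) + int (beta0 G)"

text \<open>Anti-symmetrized adjacency matrix; row/column index i (0-based) corresponds
to vertex i+1.\<close>
definition A_as :: "digraph \<Rightarrow> complex mat" where
  "A_as G = mat (nverts G) (nverts G) (\<lambda>(i, j).
      if (i + 1, j + 1) \<in> edges G then 1
      else if (j + 1, i + 1) \<in> edges G then -1 else 0)"

definition kron :: "complex mat \<Rightarrow> complex mat \<Rightarrow> complex mat" where
  "kron A B = mat (dim_row A * dim_row B) (dim_col A * dim_col B)
     (\<lambda>(i, j). A $$ (i div dim_row B, j div dim_col B) * B $$ (i mod dim_row B, j mod dim_col B))"

definition kron_list :: "complex mat list \<Rightarrow> complex mat" where
  "kron_list Ms = foldr kron Ms (1\<^sub>m 1)"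

text \<open>Factors are given as a list Gs = [G_1, ..., G_D] and gamma matrices as
gs = [gamma_1, ..., gamma_D] (0-based list indices). The mu-th summand is
(1_{n_D} (x) ... (x) A_as(G_mu) (x) ... (x) 1_{n_1}) (x) gamma_mu.\<close>
definition Dop :: "digraph list \<Rightarrow> complex mat list \<Rightarrow> nat \<Rightarrow> complex mat" where
  "Dop Gs gs r =
     foldr (+) (map (\<lambda>\<mu>. kron
        (kron_list (rev (map (\<lambda>\<nu>. if \<nu> = \<mu> then A_as (Gs ! \<nu>) else 1\<^sub>m (nverts (Gs ! \<nu>)))
                              [0..<length Gs])))
        (gs ! \<mu>)) [0..<length Gs])
       (0\<^sub>m (r * (\<Prod>G\<leftarrow>Gs. nverts G)) (r * (\<Prod>G\<leftarrow>Gs. nverts G)))"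

definition mat_rank :: "complex mat \<Rightarrow> nat" where
  "mat_rank A = vec_space.rank (dim_row A) A"

end

theory Submission
  imports Defs "Jordan_Normal_Form.Matrix_Kernel"
begin

text \<open>Write $D = \sum_\mu K_\mu \otimes \gamma_\mu$, where $K_\mu$ acts as $A_\mu$ on the
$\mu$-th tensor factor. The $K_\mu$ commute and the $\gamma_\mu$ anticommute and square to the
identity, so $D^2 = \sum_\mu K_\mu^2 \otimes 1$. Since every $K_\mu$ is skew-Hermitian,
$\langle D^2 v, v\rangle = - \sum_\mu \|(K_\mu \otimes 1) v\|^2$, and the kernel of $D$ is the
common kernel of the $K_\mu \otimes 1$. For each factor there are matrices with $R E = 1$,
$A E = 0$ and $E R + B A = 1$, that is, $E$ parametrizes the kernel of $A$. These relations pass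
to Kronecker products, so the common kernel is parametrized by
$E_D \otimes \cdots \otimes E_1 \otimes 1_r$.\<close>

subsection \<open>Kronecker products\<close>

text \<open>The matrices \<open>\<gamma> \<mu>\<close> are not assumed Hermitian, so
  \<open>D\<close> itself may fail to be skew-Hermitian; positivity becomes available only after
  squaring, once the \<open>\<gamma> \<mu>\<close> have cancelled. The norm argument is therefore
  carried by copies of the summands in which \<open>\<gamma> \<mu>\<close> is replaced by the
  identity.

  The common kernel is controlled by matrix identities instead of dimensions of tensor products of
  subspaces, because such identities survive tensoring with identity matrices. \<open>E * R\<close>
  is a projection onto the kernel of \<open>A\<close>, and \<open>E * R + B * A = 1\<close> shows
  that it fixes whatever \<open>A\<close> annihilates. A vector fixed by the projection in every
  slot is fixed by their product, hence lies in the range of the large \<open>E\<close>.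

  The values 2 and 1 come from the kernel equation \<open>w_{i+1} = w_{i-1}\<close>. On an even
  cycle the two parity classes stay separate, which leaves two free values. On a path with an odd
  number of vertices the equations at the ends kill the odd 0-based positions, which leaves
  one.\<close>

lemma sum_div_mod_mult:
  fixes f g :: "nat \<Rightarrow> 'a::comm_semiring_0"
  shows "(\<Sum>k<p * q. f (k div q) * g (k mod q)) = (\<Sum>i<p. f i) * (\<Sum>j<q. g j)"
proof -
  have "(\<Sum>k<p * q. f (k div q) * g (k mod q))
      = (\<Sum>i<p. \<Sum>k\<in>{i * q..<i * q + q}. f (k div q) * g (k mod q))"
    by (rule sum.nat_group[symmetric])
  also have "\<dots> = (\<Sum>i<p. \<Sum>j<q. f i * g j)"
  proof (rule sum.cong[OF refl])
    fix i
    have *: "(i * q + j) div q = i \<and> (i * q + j) mod q = j" if "j < q" for j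
      using that by auto
    show "(\<Sum>k\<in>{i * q..<i * q + q}. f (k div q) * g (k mod q)) = (\<Sum>j<q. f i * g j)"
      by (rule sum.reindex_bij_witness[symmetric, of _ "\<lambda>k. k - i * q" "\<lambda>j. i * q + j"])
         (use * in auto)
  qed
  finally show ?thesis by (simp add: sum_product)
qed

lemma dim_kron [simp]:
  "dim_row (kron A B) = dim_row A * dim_row B" "dim_col (kron A B) = dim_col A * dim_col B"
  by (simp_all add: kron_def)

lemma kron_carrier:
  assumes "A \<in> carrier_mat a b" "B \<in> carrier_mat c d"
  shows "kron A B \<in> carrier_mat (a * c) (b * d)"
  using assms by (intro carrier_matI) auto

lemma div_mod_less_mult:
  fixes i :: nat
  assumes "i < a * b"
  shows "i div b < a" "i mod b < b"
proof -
  have "b > 0" using assms by (cases b) auto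
  then show "i mod b < b" by simp
  show "i div b < a" using assms by (rule less_mult_imp_div_less)
qed

lemma kron_index:
  assumes "i < dim_row A * dim_row B" "j < dim_col A * dim_col B"
  shows "kron A B $$ (i, j)
    = A $$ (i div dim_row B, j div dim_col B) * B $$ (i mod dim_row B, j mod dim_col B)"
  using assms by (simp add: kron_def)

text \<open>The mixed-product rule: the inner summation index splits into quotient and remainder, so
  the sum factors. Almost every later identity is moved through tensor products by it.\<close>

lemma kron_mult:
  assumes "dim_col A = dim_row C" "dim_col B = dim_row D"
  shows "kron A B * kron C D = kron (A * C) (B * D)"
proof (rule eq_matI)
  fix i j assume "i < dim_row (kron (A * C) (B * D))" "j < dim_col (kron (A * C) (B * D))"
  then have ij: "i < dim_row A * dim_row B" "j < dim_col C * dim_col D" by auto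
  note b = div_mod_less_mult[OF ij(1)] div_mod_less_mult[OF ij(2)]
  let ?f = "\<lambda>k. A $$ (i div dim_row B, k) * C $$ (k, j div dim_col D)"
  let ?g = "\<lambda>k. B $$ (i mod dim_row B, k) * D $$ (k, j mod dim_col D)"
  have "(kron A B * kron C D) $$ (i, j)
      = (\<Sum>k<dim_row C * dim_row D. kron A B $$ (i, k) * kron C D $$ (k, j))"
    using ij assms by (simp add: scalar_prod_def atLeast0LessThan)
  also have "\<dots> = (\<Sum>k<dim_row C * dim_row D. ?f (k div dim_row D) * ?g (k mod dim_row D))"
    using ij assms by (intro sum.cong refl) (simp add: kron_index)
  also have "\<dots> = (\<Sum>k<dim_row C. ?f k) * (\<Sum>k<dim_row D. ?g k)"
    by (rule sum_div_mod_mult)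
  also have "\<dots> = kron (A * C) (B * D) $$ (i, j)"
    using ij b assms by (simp add: kron_index scalar_prod_def atLeast0LessThan)
  finally show "(kron A B * kron C D) $$ (i, j) = kron (A * C) (B * D) $$ (i, j)" .
qed auto

lemma kron_one: "kron (1\<^sub>m a) (1\<^sub>m b) = 1\<^sub>m (a * b)"
proof (rule eq_matI)
  fix i j assume ij: "i < dim_row (1\<^sub>m (a * b) :: complex mat)" "j < dim_col (1\<^sub>m (a * b) :: complex mat)"
  then have ij: "i < a * b" "j < a * b" by auto
  note b = div_mod_less_mult[OF ij(1)] div_mod_less_mult[OF ij(2)]
  have "i = j" if "i div b = j div b" "i mod b = j mod b"
  proof -
    have "i = i div b * b + i mod b" by (rule div_mult_mod_eq[symmetric])
    also have "\<dots> = j div b * b + j mod b" unfolding that ..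
    also have "\<dots> = j" by (rule div_mult_mod_eq)
    finally show ?thesis .
  qed
  then have eq: "i div b = j div b \<and> i mod b = j mod b \<longleftrightarrow> i = j" by blast
  have "kron (1\<^sub>m a) (1\<^sub>m b) $$ (i, j)
      = (if i div b = j div b then 1 else 0) * (if i mod b = j mod b then 1 else 0)"
    using ij b by (simp add: kron_index)
  also have "\<dots> = (if i div b = j div b \<and> i mod b = j mod b then 1 else 0)" by simp
  finally show "kron (1\<^sub>m a) (1\<^sub>m b) $$ (i, j) = (1\<^sub>m (a * b) :: complex mat) $$ (i, j)"
    using ij by (simp only: eq index_one_mat(1))
qed auto

lemma kron_zero_left: "kron (0\<^sub>m a b) C = 0\<^sub>m (a * dim_row C) (b * dim_col C)"
proof (rule eq_matI)
  fix i j assume "i < dim_row (0\<^sub>m (a * dim_row C) (b * dim_col C) :: complex mat)"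
    "j < dim_col (0\<^sub>m (a * dim_row C) (b * dim_col C) :: complex mat)"
  then have ij: "i < a * dim_row C" "j < b * dim_col C" by auto
  show "kron (0\<^sub>m a b) C $$ (i, j) = 0\<^sub>m (a * dim_row C) (b * dim_col C) $$ (i, j)"
    using ij div_mod_less_mult[OF ij(1)] div_mod_less_mult[OF ij(2)] by (simp add: kron_index)
qed auto

lemma kron_zero_right: "kron C (0\<^sub>m a b) = 0\<^sub>m (dim_row C * a) (dim_col C * b)"
proof (rule eq_matI)
  fix i j assume "i < dim_row (0\<^sub>m (dim_row C * a) (dim_col C * b) :: complex mat)"
    "j < dim_col (0\<^sub>m (dim_row C * a) (dim_col C * b) :: complex mat)"
  then have ij: "i < dim_row C * a" "j < dim_col C * b" by auto
  show "kron C (0\<^sub>m a b) $$ (i, j) = 0\<^sub>m (dim_row C * a) (dim_col C * b) $$ (i, j)"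
    using ij div_mod_less_mult[OF ij(1)] div_mod_less_mult[OF ij(2)] by (simp add: kron_index)
qed auto

lemma kron_add_left:
  assumes "A \<in> carrier_mat a b" "B \<in> carrier_mat a b"
  shows "kron (A + B) C = kron A C + kron B C"
proof (rule eq_matI)
  fix i j assume "i < dim_row (kron A C + kron B C)" "j < dim_col (kron A C + kron B C)"
  then have ij: "i < a * dim_row C" "j < b * dim_col C" using assms by auto
  show "kron (A + B) C $$ (i, j) = (kron A C + kron B C) $$ (i, j)"
    using assms ij div_mod_less_mult[OF ij(1)] div_mod_less_mult[OF ij(2)]
    by (simp add: kron_index distrib_right)
qed (use assms in auto)

lemma kron_add_right:
  assumes "A \<in> carrier_mat a b" "B \<in> carrier_mat a b"
  shows "kron C (A + B) = kron C A + kron C B"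
proof (rule eq_matI)
  fix i j assume "i < dim_row (kron C A + kron C B)" "j < dim_col (kron C A + kron C B)"
  then have ij: "i < dim_row C * a" "j < dim_col C * b" using assms by auto
  show "kron C (A + B) $$ (i, j) = (kron C A + kron C B) $$ (i, j)"
    using assms ij div_mod_less_mult[OF ij(1)] div_mod_less_mult[OF ij(2)]
    by (simp add: kron_index distrib_left)
qed (use assms in auto)

text \<open>\<open>s = 1\<close> is Hermitian and \<open>s = - 1\<close> is skew-Hermitian. Keeping
  the sign as a parameter lets one closure rule cover Kronecker products that mix both kinds, the
  signs being multiplied.\<close>

definition star_sym :: "complex \<Rightarrow> complex mat \<Rightarrow> bool" where
  "star_sym s A \<longleftrightarrow> square_mat A \<and>
     (\<forall>i<dim_row A. \<forall>j<dim_row A. A $$ (j, i) = s * cnj (A $$ (i, j)))"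

lemma star_sym_kron:
  assumes "star_sym s A" "star_sym t B"
  shows "star_sym (s * t) (kron A B)"
  unfolding star_sym_def
proof (intro conjI allI impI)
  have sq: "dim_row A = dim_col A" "dim_row B = dim_col B"
    using assms by (auto simp: star_sym_def)
  then show "square_mat (kron A B)" by simp
  fix i j assume ij: "i < dim_row (kron A B)" "j < dim_row (kron A B)"
  let ?i1 = "i div dim_col B" and ?i2 = "i mod dim_col B"
  let ?j1 = "j div dim_col B" and ?j2 = "j mod dim_col B"
  have b: "?i1 < dim_col A" "?i2 < dim_col B" "?j1 < dim_col A" "?j2 < dim_col B"
    using ij sq by (auto intro!: div_mod_less_mult)
  have A: "A $$ (?j1, ?i1) = s * cnj (A $$ (?i1, ?j1))"
    using assms(1) b sq unfolding star_sym_def by metis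
  have B: "B $$ (?j2, ?i2) = t * cnj (B $$ (?i2, ?j2))"
    using assms(2) b sq unfolding star_sym_def by metis
  have "kron A B $$ (j, i) = A $$ (?j1, ?i1) * B $$ (?j2, ?i2)"
    using ij sq by (simp add: kron_index)
  also have "\<dots> = s * t * (cnj (A $$ (?i1, ?j1)) * cnj (B $$ (?i2, ?j2)))"
    unfolding A B by (simp only: ac_simps)
  also have "cnj (A $$ (?i1, ?j1)) * cnj (B $$ (?i2, ?j2)) = cnj (kron A B $$ (i, j))"
    using ij sq by (simp add: kron_index)
  finally show "kron A B $$ (j, i) = s * t * cnj (kron A B $$ (i, j))" .
qed

lemma star_sym_one: "star_sym 1 (1\<^sub>m n)"
  by (auto simp: star_sym_def)

section \<open>Kronecker products of lists, slot by slot\<close>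

lemma kron_list_Nil [simp]: "kron_list [] = 1\<^sub>m 1"
  and kron_list_Cons [simp]: "kron_list (A # As) = kron A (kron_list As)"
  by (simp_all add: kron_list_def)

lemma dim_kron_list [simp]:
  "dim_row (kron_list As) = prod_list (map dim_row As)"
  "dim_col (kron_list As) = prod_list (map dim_col As)"
  by (induction As) auto

lemma kron_list_map_carrier:
  assumes "\<And>\<nu>. \<nu> \<in> set L \<Longrightarrow> f \<nu> \<in> carrier_mat (a \<nu>) (b \<nu>)"
  shows "kron_list (map f L) \<in> carrier_mat (prod_list (map a L)) (prod_list (map b L))"
  using assms by (induction L) (auto intro!: kron_carrier)

lemma kron_list_map_mult:
  assumes "\<And>\<nu>. \<nu> \<in> set L \<Longrightarrow> dim_col (f \<nu>) = dim_row (g \<nu>)"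
  shows "kron_list (map f L) * kron_list (map g L) = kron_list (map (\<lambda>\<nu>. f \<nu> * g \<nu>) L)"
  using assms
proof (induction L)
  case (Cons \<mu> L)
  have "map (dim_col \<circ> f) L = map (dim_row \<circ> g) L" using Cons.prems by auto
  then have "dim_col (kron_list (map f L)) = dim_row (kron_list (map g L))"
    by (simp del: map_eq_conv)
  with Cons show ?case by (simp add: kron_mult)
qed simp

lemma kron_list_map_one: "kron_list (map (\<lambda>\<nu>. 1\<^sub>m (n \<nu>)) L) = 1\<^sub>m (prod_list (map n L))"
  by (induction L) (auto simp: kron_one)

lemma kron_list_map_zero:
  assumes "\<And>\<nu>. \<nu> \<in> set L \<Longrightarrow> f \<nu> \<in> carrier_mat (a \<nu>) (b \<nu>)"
    and "\<mu> \<in> set L" "f \<mu> = 0\<^sub>m (a \<mu>) (b \<mu>)"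
  shows "kron_list (map f L) = 0\<^sub>m (prod_list (map a L)) (prod_list (map b L))"
  using assms
proof (induction L)
  case (Cons \<kappa> L)
  have c: "kron_list (map f L) \<in> carrier_mat (prod_list (map a L)) (prod_list (map b L))"
    using Cons.prems by (intro kron_list_map_carrier) auto
  have \<kappa>: "f \<kappa> \<in> carrier_mat (a \<kappa>) (b \<kappa>)" using Cons.prems by auto
  show ?case
  proof (cases "\<mu> = \<kappa>")
    case True
    then show ?thesis using Cons.prems(3) carrier_matD[OF c] by (simp add: kron_zero_left)
  next
    case False
    then have "kron_list (map f L) = 0\<^sub>m (prod_list (map a L)) (prod_list (map b L))"
      using Cons by auto
    then show ?thesis using carrier_matD[OF \<kappa>] by (simp add: kron_zero_right)
  qed
qed simp

text \<open>Multilinearity in the single slot \<open>\<mu>\<close>. Distinctness of \<open>L\<close>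
  matters: if \<open>\<mu>\<close> occurred twice, the left side would also contain mixed terms. It
  serves to split an identity matrix in one slot.\<close>

lemma kron_list_map_add:
  assumes "\<And>\<nu>. \<nu> \<in> set L \<Longrightarrow> f \<nu> \<in> carrier_mat (a \<nu>) (b \<nu>)"
    and "\<And>\<nu>. \<nu> \<in> set L \<Longrightarrow> g \<nu> \<in> carrier_mat (a \<nu>) (b \<nu>)"
    and "\<mu> \<in> set L" "distinct L"
    and "\<And>\<nu>. \<nu> \<in> set L \<Longrightarrow> \<nu> \<noteq> \<mu> \<Longrightarrow> f \<nu> = h \<nu> \<and> g \<nu> = h \<nu>"
    and "h \<mu> = f \<mu> + g \<mu>"
  shows "kron_list (map h L) = kron_list (map f L) + kron_list (map g L)"
  using assms
proof (induction L)
  case (Cons \<kappa> L)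
  have c: "kron_list (map f L) \<in> carrier_mat (prod_list (map a L)) (prod_list (map b L))"
    "kron_list (map g L) \<in> carrier_mat (prod_list (map a L)) (prod_list (map b L))"
    using Cons.prems by (auto intro!: kron_list_map_carrier)
  have \<kappa>: "f \<kappa> \<in> carrier_mat (a \<kappa>) (b \<kappa>)" "g \<kappa> \<in> carrier_mat (a \<kappa>) (b \<kappa>)"
    using Cons.prems by auto
  show ?case
  proof (cases "\<mu> = \<kappa>")
    case True
    \<comment> \<open>By distinctness \<open>\<mu>\<close> does not recur in the tail, so the three
      tails coincide and only the head is additive.\<close>
    then have "\<forall>\<nu>\<in>set L. f \<nu> = h \<nu> \<and> g \<nu> = h \<nu>" using Cons.prems by auto
    then have "map f L = map h L" "map g L = map h L" by (meson map_cong)+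
    then show ?thesis
      using True Cons.prems(6) kron_add_left[OF \<kappa>] by (simp del: map_eq_conv)
  next
    case False
    then have "kron_list (map h L) = kron_list (map f L) + kron_list (map g L)"
      using Cons by auto
    moreover have "f \<kappa> = h \<kappa>" "g \<kappa> = h \<kappa>" using Cons.prems(5)[of \<kappa>] False by auto
    ultimately show ?thesis using kron_add_right[OF c] by simp
  qed
qed simp

lemma star_sym_kron_list_map:
  assumes "\<And>\<nu>. \<nu> \<in> set L \<Longrightarrow> star_sym (s \<nu>) (f \<nu>)"
  shows "star_sym (prod_list (map s L)) (kron_list (map f L))"
  using assms
  by (induction L) (auto intro: star_sym_kron star_sym_one[of 1, simplified])

section \<open>Sums of matrices over a list, anticommutation and squares\<close>

lemma add_mat_interchange:
  fixes A :: "'a::comm_monoid_add mat"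
  assumes "A \<in> carrier_mat a b" "B \<in> carrier_mat a b" "C \<in> carrier_mat a b" "D \<in> carrier_mat a b"
  shows "(A + B) + (C + D) = (A + C) + (B + D)"
  by (rule eq_matI) (use assms in \<open>auto simp: ac_simps\<close>)

lemma foldr_add_mat_carrier:
  fixes M :: "'b \<Rightarrow> 'a::comm_ring_1 mat"
  assumes "\<And>\<mu>. \<mu> \<in> set I \<Longrightarrow> M \<mu> \<in> carrier_mat n n"
  shows "foldr (+) (map M I) (0\<^sub>m n n) \<in> carrier_mat n n"
  using assms by (induction I) auto

lemma foldr_add_mat_anticommute:
  fixes M :: "'b \<Rightarrow> 'a::comm_ring_1 mat"
  assumes "\<And>\<mu>. \<mu> \<in> set I \<Longrightarrow> M \<mu> \<in> carrier_mat n n" "X \<in> carrier_mat n n"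
    and "\<And>\<mu>. \<mu> \<in> set I \<Longrightarrow> X * M \<mu> + M \<mu> * X = 0\<^sub>m n n"
  shows "X * foldr (+) (map M I) (0\<^sub>m n n) + foldr (+) (map M I) (0\<^sub>m n n) * X = 0\<^sub>m n n"
  using assms
proof (induction I)
  case (Cons \<mu> I)
  define S where S_def: "S = foldr (+) (map M I) (0\<^sub>m n n)"
  have S [simp]: "S \<in> carrier_mat n n"
    unfolding S_def using Cons.prems by (intro foldr_add_mat_carrier) auto
  have c [simp]: "M \<mu> \<in> carrier_mat n n" "X \<in> carrier_mat n n" using Cons.prems by auto
  have "X * (M \<mu> + S) + (M \<mu> + S) * X = (X * M \<mu> + X * S) + (M \<mu> * X + S * X)"
    using mult_add_distrib_mat[OF c(2,1) S] add_mult_distrib_mat[OF c(1) S c(2)] by simp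
  also have "\<dots> = (X * M \<mu> + M \<mu> * X) + (X * S + S * X)"
    by (rule add_mat_interchange[OF mult_carrier_mat[OF c(2,1)] mult_carrier_mat[OF c(2) S]
          mult_carrier_mat[OF c(1,2)] mult_carrier_mat[OF S c(2)]])
  finally have "X * (M \<mu> + S) + (M \<mu> + S) * X = (X * M \<mu> + M \<mu> * X) + (X * S + S * X)" .
  moreover have "X * S + S * X = 0\<^sub>m n n" unfolding S_def using Cons by auto
  ultimately show ?case using Cons.prems(3)[of \<mu>] by (simp add: S_def)
qed simp

text \<open>Splitting off one summand, the cross terms \<open>M \<mu> * S + S * M \<mu>\<close>
  vanish because \<open>M \<mu>\<close> anticommutes with every summand of \<open>S\<close>;
  \<open>distinct I\<close> guarantees that \<open>\<mu>\<close> is not itself among them.\<close>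

lemma foldr_add_mat_square:
  fixes M :: "'b \<Rightarrow> 'a::comm_ring_1 mat"
  assumes "\<And>\<mu>. \<mu> \<in> set I \<Longrightarrow> M \<mu> \<in> carrier_mat n n" "distinct I"
    and "\<And>\<mu> \<nu>. \<mu> \<in> set I \<Longrightarrow> \<nu> \<in> set I \<Longrightarrow> \<mu> \<noteq> \<nu> \<Longrightarrow> M \<mu> * M \<nu> + M \<nu> * M \<mu> = 0\<^sub>m n n"
  shows "foldr (+) (map M I) (0\<^sub>m n n) * foldr (+) (map M I) (0\<^sub>m n n)
    = foldr (+) (map (\<lambda>\<mu>. M \<mu> * M \<mu>) I) (0\<^sub>m n n)"
  using assms
proof (induction I)
  case (Cons \<mu> I)
  define S where S_def: "S = foldr (+) (map M I) (0\<^sub>m n n)"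
  have S [simp]: "S \<in> carrier_mat n n"
    unfolding S_def using Cons.prems by (intro foldr_add_mat_carrier) auto
  have c [simp]: "M \<mu> \<in> carrier_mat n n" using Cons.prems by auto
  have "(M \<mu> + S) * (M \<mu> + S) = (M \<mu> * M \<mu> + M \<mu> * S) + (S * M \<mu> + S * S)"
    using mult_add_distrib_mat[OF c c S] mult_add_distrib_mat[OF S c S]
      add_mult_distrib_mat[OF c S add_carrier_mat[OF S]] by simp
  also have "\<dots> = M \<mu> * M \<mu> + (M \<mu> * S + S * M \<mu>) + S * S"
    using assoc_add_mat[of "M \<mu> * M \<mu>" n n "M \<mu> * S" "S * M \<mu> + S * S"]
      assoc_add_mat[of "M \<mu> * S" n n "S * M \<mu>" "S * S"]
      assoc_add_mat[of "M \<mu> * M \<mu>" n n "M \<mu> * S + S * M \<mu>" "S * S"]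
      mult_carrier_mat[OF c c] mult_carrier_mat[OF c S] mult_carrier_mat[OF S c]
      mult_carrier_mat[OF S S] by simp
  also have "M \<mu> * S + S * M \<mu> = 0\<^sub>m n n"
    unfolding S_def using Cons.prems by (intro foldr_add_mat_anticommute) auto
  finally have "(M \<mu> + S) * (M \<mu> + S) = M \<mu> * M \<mu> + S * S"
    using mult_carrier_mat[OF c c] by simp
  moreover have "S * S = foldr (+) (map (\<lambda>\<mu>. M \<mu> * M \<mu>) I) (0\<^sub>m n n)"
    unfolding S_def using Cons by auto
  ultimately show ?case by (simp add: S_def)
qed simp

text \<open>Stated for the bilinear product; the Hermitian form is recovered by taking
  \<open>w\<close> to be \<open>conjugate v\<close>.\<close>

lemma foldr_add_mat_scalar_prod:
  fixes M :: "'b \<Rightarrow> 'a::comm_ring_1 mat"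
  assumes "\<And>\<mu>. \<mu> \<in> set I \<Longrightarrow> M \<mu> \<in> carrier_mat n n" "v \<in> carrier_vec n" "w \<in> carrier_vec n"
  shows "(foldr (+) (map M I) (0\<^sub>m n n) *\<^sub>v v) \<bullet> w = (\<Sum>\<mu>\<leftarrow>I. (M \<mu> *\<^sub>v v) \<bullet> w)"
  using assms
proof (induction I)
  case (Cons \<mu> I)
  define S where S_def: "S = foldr (+) (map M I) (0\<^sub>m n n)"
  have S [simp]: "S \<in> carrier_mat n n"
    unfolding S_def using Cons.prems by (intro foldr_add_mat_carrier) auto
  have c [simp]: "M \<mu> \<in> carrier_mat n n" using Cons.prems by auto
  have v: "M \<mu> *\<^sub>v v \<in> carrier_vec n" "S *\<^sub>v v \<in> carrier_vec n"
    using c S Cons.prems(2) by (auto simp del: c S)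
  have "(M \<mu> + S) *\<^sub>v v = M \<mu> *\<^sub>v v + S *\<^sub>v v"
    by (rule add_mult_distrib_mat_vec[OF c S Cons.prems(2)])
  then have "((M \<mu> + S) *\<^sub>v v) \<bullet> w = (M \<mu> *\<^sub>v v) \<bullet> w + (S *\<^sub>v v) \<bullet> w"
    using add_scalar_prod_distrib[OF v Cons.prems(3)] by simp
  moreover have "(S *\<^sub>v v) \<bullet> w = (\<Sum>\<mu>\<leftarrow>I. (M \<mu> *\<^sub>v v) \<bullet> w)"
    unfolding S_def using Cons by auto
  ultimately show ?case by (simp add: S_def)
qed (simp add: scalar_prod_def)

lemma foldr_add_mat_mult_zero:
  fixes M :: "'b \<Rightarrow> 'a::comm_ring_1 mat"
  assumes "\<And>\<mu>. \<mu> \<in> set I \<Longrightarrow> M \<mu> \<in> carrier_mat n n" "X \<in> carrier_mat n k"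
    and "\<And>\<mu>. \<mu> \<in> set I \<Longrightarrow> M \<mu> * X = 0\<^sub>m n k"
  shows "foldr (+) (map M I) (0\<^sub>m n n) * X = 0\<^sub>m n k"
  using assms
proof (induction I)
  case (Cons \<mu> I)
  define S where S_def: "S = foldr (+) (map M I) (0\<^sub>m n n)"
  have S [simp]: "S \<in> carrier_mat n n"
    unfolding S_def using Cons.prems by (intro foldr_add_mat_carrier) auto
  have "(M \<mu> + S) * X = M \<mu> * X + S * X"
    using Cons.prems S by (intro add_mult_distrib_mat[of _ n n]) auto
  moreover have "S * X = 0\<^sub>m n k" unfolding S_def using Cons by auto
  ultimately show ?case using Cons.prems(3)[of \<mu>] by (simp add: S_def)
qed simp

text \<open>Since \<open>\<bullet>c\<close> conjugates its right argument, moving one factor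
  \<open>X\<close> across it produces the conjugate transpose, which is \<open>- X\<close>.\<close>

lemma star_sym_square_scalar_prod:
  assumes X: "X \<in> carrier_mat n n" "star_sym (- 1) X" and v: "v \<in> carrier_vec n"
  shows "((X * X) *\<^sub>v v) \<bullet>c v = - ((X *\<^sub>v v) \<bullet>c (X *\<^sub>v v))"
proof -
  let ?w = "X *\<^sub>v v"
  have w: "?w \<in> carrier_vec n" using X v by auto
  have "((X * X) *\<^sub>v v) = X *\<^sub>v ?w" using X v by auto
  then have "((X * X) *\<^sub>v v) \<bullet>c v = (\<Sum>i<n. (\<Sum>j<n. X $$ (i, j) * ?w $ j) * cnj (v $ i))"
    using X v w by (simp add: scalar_prod_def atLeast0LessThan mult_mat_vec_def del: assoc_mult_mat_vec)
  also have "\<dots> = (\<Sum>i<n. \<Sum>j<n. X $$ (i, j) * ?w $ j * cnj (v $ i))"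
    by (simp add: sum_distrib_right)
  also have "\<dots> = (\<Sum>j<n. \<Sum>i<n. X $$ (i, j) * ?w $ j * cnj (v $ i))"
    by (rule sum.swap)
  also have "\<dots> = (\<Sum>j<n. \<Sum>i<n. - (?w $ j * cnj (X $$ (j, i) * v $ i)))"
  proof (intro sum.cong refl)
    fix i j assume "i \<in> {..<n}" "j \<in> {..<n}"
    then have "X $$ (j, i) = - 1 * cnj (X $$ (i, j))"
      using X unfolding star_sym_def by (metis carrier_matD(1) lessThan_iff)
    then show "X $$ (j, i) * ?w $ i * cnj (v $ j) = - (?w $ i * cnj (X $$ (i, j) * v $ j))"
      by simp
  qed
  also have "\<dots> = - (\<Sum>j<n. ?w $ j * cnj (\<Sum>i<n. X $$ (j, i) * v $ i))"
    by (simp add: sum_negf sum_distrib_left)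
  also have "\<dots> = - (?w \<bullet>c ?w)"
    using X v w by (simp add: scalar_prod_def atLeast0LessThan mult_mat_vec_def)
  finally show ?thesis .
qed

subsection \<open>Rank and kernel\<close>

lemma linear_map_mult_mat_vec:
  fixes A :: "'a::field mat"
  assumes "A \<in> carrier_mat m n"
  shows "linear_map class_ring (module_vec TYPE('a) n) (module_vec TYPE('a) m) ((*\<^sub>v) A)"
proof -
  interpret V: vec_space "TYPE('a)" n .
  interpret W: vec_space "TYPE('a)" m .
  have "(*\<^sub>v) A \<in> LinearCombinations.module_hom class_ring V.V W.V"
    unfolding LinearCombinations.module_hom_def module_vec_simps
    using mult_add_distrib_mat_vec[OF assms] mult_mat_vec[OF assms] mult_mat_vec_carrier[OF assms]
    by auto
  then show ?thesis
    by (intro linear_map.intro mod_hom.intro mod_hom_axioms.intro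
        V.vectorspace_axioms W.vectorspace_axioms V.module_axioms W.module_axioms)
qed

text \<open>The rank is the dimension of the column span, and that span is the image of the linear
  map given by \<open>A\<close>, so rank-nullity applies.\<close>

lemma rank_plus_dim_kernel:
  fixes A :: "'a::field mat"
  assumes "A \<in> carrier_mat m n"
  shows "vec_space.rank m A
      + vectorspace.dim class_ring ((module_vec TYPE('a) n)\<lparr>carrier := mat_kernel A\<rparr>) = n"
proof -
  interpret V: vec_space "TYPE('a)" n .
  interpret W: vec_space "TYPE('a)" m .
  interpret linear_map class_ring V.V W.V "(*\<^sub>v) A"
    by (rule linear_map_mult_mat_vec[OF assms])
  have im: "imT = W.span (set (cols A))"
  proof -
    have "A *\<^sub>v x \<in> carrier_vec m" if "x \<in> carrier_vec n" for x
      using assms that by simp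
    then have "(*\<^sub>v) A ` carrier_vec n = {y \<in> carrier_vec m. \<exists>x\<in>carrier_vec n. A *\<^sub>v x = y}"
      by blast
    then show ?thesis
      unfolding im_def module_vec_simps
      using W.col_space_eq[OF assms] carrier_matD[OF assms] unfolding W.col_space_def by metis
  qed
  have ker: "kerT = mat_kernel A"
    unfolding ker_def mat_kernel[OF assms] module_vec_simps ..
  show ?thesis
    using rank_nullity[OF V.fin_dim] unfolding im ker W.rank_def V.dim_is_n .
qed

text \<open>\<open>R\<close> makes \<open>E\<close> injective, \<open>A * E = 0\<close> puts its
  image inside the kernel of \<open>A\<close>, and the last hypothesis makes it all of that kernel,
  which thus has dimension \<open>k\<close>. The last hypothesis speaks of kernel vectors rather
  than being a matrix identity because for the full operator it is derived from a positivity
  argument on vectors.\<close>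

lemma rank_plus_kernel_parametrization:
  fixes A :: "'a::field mat"
  assumes A: "A \<in> carrier_mat m n" and E: "E \<in> carrier_mat n k" and R: "R \<in> carrier_mat k n"
    and RE: "R * E = 1\<^sub>m k" and AE: "A * E = 0\<^sub>m m k"
    and ker: "\<And>v. v \<in> carrier_vec n \<Longrightarrow> A *\<^sub>v v = 0\<^sub>v m \<Longrightarrow> (E * R) *\<^sub>v v = v"
  shows "vec_space.rank m A + k = n"
proof -
  interpret V: vec_space "TYPE('a)" n .
  interpret K: vec_space "TYPE('a)" k .
  interpret linear_map class_ring K.V V.V "(*\<^sub>v) E"
    by (rule linear_map_mult_mat_vec[OF E])
  have RE_vec: "R *\<^sub>v (E *\<^sub>v x) = x" if "x \<in> carrier_vec k" for x
    using that RE assoc_mult_mat_vec[OF R E that] by simp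
  have inj: "inj_on ((*\<^sub>v) E) (carrier K.V)"
    unfolding module_vec_simps by (rule inj_on_inverseI[of _ "(*\<^sub>v) R"]) (rule RE_vec)
  have "imT = mat_kernel A"
  proof (intro equalityI subsetI)
    fix v assume "v \<in> imT"
    then obtain x where x: "x \<in> carrier_vec k" "v = E *\<^sub>v x"
      unfolding im_def module_vec_simps by blast
    have "A *\<^sub>v v = 0\<^sub>m m k *\<^sub>v x" using x assoc_mult_mat_vec[OF A E x(1)] AE by simp
    also have "\<dots> = 0\<^sub>v m" using x by (intro eq_vecI) (simp_all add: scalar_prod_def)
    finally have "A *\<^sub>v v = 0\<^sub>v m" .
    moreover have "v \<in> carrier_vec n" using x E by simp
    ultimately show "v \<in> mat_kernel A" using mat_kernelI[OF A] by blast
  next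
    fix v assume "v \<in> mat_kernel A"
    note v = mat_kernelD[OF A this]
    have "v = E *\<^sub>v (R *\<^sub>v v)" using ker[OF v] assoc_mult_mat_vec[OF E R v(1)] by simp
    moreover have "R *\<^sub>v v \<in> carrier_vec k" using R v by simp
    ultimately show "v \<in> imT" unfolding im_def module_vec_simps by blast
  qed
  \<comment> \<open>Rank-nullity is applied to \<open>E\<close> here: its null space is trivial, so
    its image has the full dimension \<open>k\<close>.\<close>
  then have "vectorspace.dim class_ring (V.V\<lparr>carrier := mat_kernel A\<rparr>) = k"
    using rank_nullity[OF K.fin_dim] inj_imp_dim_ker0[OF inj] K.dim_is_n
    by (metis add.right_neutral)
  then show ?thesis using rank_plus_dim_kernel[OF A] by simp
qed

subsection \<open>Paths and cycles\<close>

text \<open>A difference of indicators instead of a nested conditional, so that sums against it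
  split linearly. Indices are 0-based.\<close>

definition path_entry :: "nat \<Rightarrow> nat \<Rightarrow> complex" where
  "path_entry i k = of_bool (k = Suc i) - of_bool (i = Suc k)"

definition cycle_entry :: "nat \<Rightarrow> nat \<Rightarrow> nat \<Rightarrow> complex" where
  "cycle_entry n i k = path_entry i k + of_bool (Suc i = n \<and> k = 0) - of_bool (i = 0 \<and> Suc k = n)"

lemma nverts_path [simp]: "nverts (path_digraph n) = n"
  and nverts_cycle [simp]: "nverts (cycle_digraph n) = n"
  by (simp_all add: nverts_def path_digraph_def cycle_digraph_def)

lemma edges_path: "edges (path_digraph n) = {(i, i + 1) | i. 1 \<le> i \<and> i \<le> n - 1}"
  and edges_cycle: "edges (cycle_digraph n) = insert (n, 1) (edges (path_digraph n))"
  by (auto simp: edges_def path_digraph_def cycle_digraph_def)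

lemma A_as_path: "A_as (path_digraph n) = mat n n (\<lambda>(i, k). path_entry i k)"
  by (rule eq_matI) (auto simp: A_as_def edges_path path_entry_def)

text \<open>For \<open>n = 2\<close> the closing edge would reverse the edge from 1 to 2: the
  conditional in \<open>A_as\<close> would then give 1 in both places, while the indicators would
  cancel to 0. From \<open>n = 3\<close> on, no edge is the reverse of another.\<close>

lemma A_as_cycle:
  assumes "n \<ge> 3"
  shows "A_as (cycle_digraph n) = mat n n (\<lambda>(i, k). cycle_entry n i k)"
  by (rule eq_matI)
     (use assms in \<open>auto simp: A_as_def edges_path edges_cycle path_entry_def cycle_entry_def\<close>)

text \<open>This is a row vector times the path matrix, as needed for \<open>B * A\<close>. Column 0
  is separate because truncated subtraction would read \<open>k - 1\<close> as 0 there.\<close>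

lemma sum_path_entry_left:
  assumes "k < n"
  shows "(\<Sum>i<n. b i * path_entry i k)
    = (if k = 0 then 0 else b (k - 1)) - (if Suc k < n then b (Suc k) else 0)"
proof -
  have "(\<Sum>i<n. b i * path_entry i k)
      = (\<Sum>i<n. b i * of_bool (k = Suc i)) - (\<Sum>i<n. b i * of_bool (i = Suc k))"
    by (simp add: path_entry_def right_diff_distrib sum_subtractf)
  also have "(\<Sum>i<n. b i * of_bool (i = Suc k)) = (if Suc k < n then b (Suc k) else 0)"
    by (simp add: of_bool_def if_distrib cong: if_cong)
  also have "(\<Sum>i<n. b i * of_bool (k = Suc i)) = (if k = 0 then 0 else b (k - 1))"
  proof (cases k)
    case (Suc m)
    then show ?thesis using assms by (simp add: of_bool_def if_distrib cong: if_cong)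
  qed simp
  finally show ?thesis .
qed

lemma sum_of_bool_eq_mult:
  fixes f :: "nat \<Rightarrow> complex"
  assumes "c < n"
  shows "(\<Sum>k<n. of_bool (k = c) * f k) = f c"
proof -
  have "(\<Sum>k<n. of_bool (k = c) * f k) = (\<Sum>k<n. if k = c then f k else 0)"
    by (intro sum.cong refl) auto
  then show ?thesis using assms by simp
qed

lemma path_entry_swap: "path_entry k i = - path_entry i k"
  by (simp add: path_entry_def)

lemma cycle_entry_swap: "cycle_entry n k i = - cycle_entry n i k"
  by (auto simp: cycle_entry_def path_entry_def)

lemma sum_path_entry_right:
  assumes "i < n"
  shows "(\<Sum>k<n. path_entry i k * e k)
    = (if Suc i < n then e (Suc i) else 0) - (if i = 0 then 0 else e (i - 1))"
proof -
  have "(\<Sum>k<n. path_entry i k * e k) = - (\<Sum>k<n. e k * path_entry k i)"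
    unfolding sum_negf[symmetric]
    by (intro sum.cong refl) (simp add: path_entry_swap[of i])
  then show ?thesis unfolding sum_path_entry_left[OF assms] by simp
qed

lemma sum_cycle_entry_left:
  assumes "k < n"
  shows "(\<Sum>i<n. b i * cycle_entry n i k) = (\<Sum>i<n. b i * path_entry i k)
    + (if k = 0 then b (n - 1) else 0) - (if Suc k = n then b 0 else 0)"
proof -
  have "(\<Sum>i<n. b i * cycle_entry n i k) = (\<Sum>i<n. b i * path_entry i k)
      + (\<Sum>i<n. b i * of_bool (Suc i = n \<and> k = 0)) - (\<Sum>i<n. b i * of_bool (i = 0 \<and> Suc k = n))"
    by (simp add: cycle_entry_def algebra_simps sum.distrib sum_subtractf)
  also have "(\<Sum>i<n. b i * of_bool (Suc i = n \<and> k = 0))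
      = (\<Sum>i<n. if i = n - 1 then (if k = 0 then b i else 0) else 0)"
    using assms by (intro sum.cong refl) auto
  also have "\<dots> = (if k = 0 then b (n - 1) else 0)"
    using assms by simp
  also have "(\<Sum>i<n. b i * of_bool (i = 0 \<and> Suc k = n))
      = (\<Sum>i<n. if i = 0 then (if Suc k = n then b i else 0) else 0)"
    by (intro sum.cong refl) auto
  also have "\<dots> = (if Suc k = n then b 0 else 0)"
    using assms by simp
  finally show ?thesis .
qed

lemma sum_cycle_entry_right:
  assumes "i < n"
  shows "(\<Sum>k<n. cycle_entry n i k * e k) = (\<Sum>k<n. path_entry i k * e k)
    - (if i = 0 then e (n - 1) else 0) + (if Suc i = n then e 0 else 0)"
proof -
  have "(\<Sum>k<n. cycle_entry n i k * e k) = - (\<Sum>k<n. e k * cycle_entry n k i)"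
    unfolding sum_negf[symmetric]
    by (intro sum.cong refl) (simp add: cycle_entry_swap[of _ i])
  moreover have "(\<Sum>k<n. path_entry i k * e k) = - (\<Sum>k<n. e k * path_entry k i)"
    unfolding sum_negf[symmetric]
    by (intro sum.cong refl) (simp add: path_entry_swap[of i])
  ultimately show ?thesis unfolding sum_cycle_entry_left[OF assms] by simp
qed

text \<open>\<open>E\<close> embeds coordinates of the kernel, \<open>R\<close> reads them off, and
  \<open>B\<close> recovers from \<open>A v\<close> the part of \<open>v\<close> that
  \<open>E * R\<close> misses.\<close>

definition kernel_split :: "complex mat \<Rightarrow> nat \<Rightarrow> nat \<Rightarrow> complex mat \<Rightarrow> complex mat \<Rightarrow> complex mat \<Rightarrow> bool"
  where "kernel_split A n k E R B \<longleftrightarrow>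
     A \<in> carrier_mat n n \<and> E \<in> carrier_mat n k \<and> R \<in> carrier_mat k n \<and> B \<in> carrier_mat n n \<and>
     R * E = 1\<^sub>m k \<and> A * E = 0\<^sub>m n k \<and> E * R + B * A = 1\<^sub>m n"

lemma mat_times_mat:
  "mat a b f * mat b c g = mat a c (\<lambda>(i, j). \<Sum>k<b. f (i, k) * g (k, j))"
  by (rule eq_matI) (auto simp: scalar_prod_def atLeast0LessThan)

lemma mat_plus_mat: "mat a b f + mat a b g = mat a b (\<lambda>(i, j). f (i, j) + g (i, j))"
  by (rule eq_matI) auto

text \<open>The left factor \<open>B\<close> sums the recurrence $(A w)_i = w_{i+1} - w_{i-1}$ along one parity class:
for a path $w_j = [j\ \mathrm{even}]\, w_0 + \sum (A w)_i$ over $i < j$ with $i + j$ odd, and for a cycle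
$w_j = w_{j \bmod 2} + \sum (A w)_i$ over $0 < i < j$ with $i + j$ odd.\<close>

lemma kernel_split_path:
  assumes "odd n"
  shows "\<exists>E R B. kernel_split (A_as (path_digraph n)) n 1 E R B"
proof -
  define A where "A = mat n n (\<lambda>(i, k). path_entry i k)"
  \<comment> \<open>Row 0 of the kernel equation forces entry 1 to vanish and hence all odd entries;
    the even entries are all equal. \<open>R\<close> reads entry 0.\<close>
  define E where "E = mat n 1 (\<lambda>(j, c). of_bool (even j) :: complex)"
  define R where "R = mat 1 n (\<lambda>(c, k). of_bool (k = c) :: complex)"
  define B where "B = mat n n (\<lambda>(j, i). of_bool (i < j \<and> odd (i + j)) :: complex)"
  have n: "n > 0" using assms by (cases n) auto
  have "R * E = 1\<^sub>m 1"
    unfolding R_def E_def mat_times_mat one_mat_def using n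
    by (intro cong_mat refl) (simp add: sum_of_bool_eq_mult)
  moreover have "A * E = 0\<^sub>m n 1"
    unfolding A_def E_def mat_times_mat zero_mat_def
  proof (intro cong_mat refl, unfold prod.case)
    fix i assume i: "i < n"
    \<comment> \<open>The last index \<open>n - 1\<close> is even, so an odd row always has both
      neighbours, whose entries 1 cancel. Even rows only meet zeros.\<close>
    have *: "Suc i < n" if "odd i" using that i assms by presburger
    show "(\<Sum>k<n. path_entry i k * of_bool (even k)) = 0"
      unfolding sum_path_entry_right[OF i] using * i assms by (cases i) auto
  qed
  moreover have "E * R + B * A = 1\<^sub>m n"
    unfolding A_def B_def E_def R_def mat_times_mat mat_plus_mat one_mat_def
  proof (intro cong_mat refl, unfold prod.case)
    fix j k assume jk: "j < n" "k < n"
    have "(\<Sum>c<1. of_bool (even j) * of_bool (k = c)) = (of_bool (even j \<and> k = 0) :: complex)"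
      by simp
    \<comment> \<open>For \<open>k \<ge> 1\<close> the two indicators cancel unless
      \<open>k - 1 < j \<le> k + 1\<close>, and parity then leaves only \<open>j = k\<close>. In
      column 0 the first indicator is absent and the entry of \<open>E * R\<close> stands in for
      it.\<close>
    moreover have "of_bool (even j \<and> k = 0)
        + ((if k = 0 then 0 else of_bool (k - 1 < j \<and> odd (k - 1 + j)))
        - (if Suc k < n then of_bool (Suc k < j \<and> odd (Suc k + j)) else 0))
        = (of_bool (j = k) :: complex)"
    proof -
      consider "j < k" | "j = k" | "j = Suc k" | "Suc k < j" by linarith
      then show ?thesis using jk by cases (cases k; simp)+
    qed
    ultimately show "(\<Sum>c<1. of_bool (even j) * of_bool (k = c))
        + (\<Sum>i<n. of_bool (i < j \<and> odd (i + j)) * path_entry i k)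
        = (if j = k then 1 else (0 :: complex))"
      unfolding sum_path_entry_left[OF jk(2)] by simp
  qed
  ultimately have "kernel_split A n 1 E R B"
    by (simp add: kernel_split_def A_def E_def R_def B_def)
  then show ?thesis unfolding A_as_path A_def by blast
qed

lemma kernel_split_cycle:
  assumes "even n" "n \<ge> 3"
  shows "\<exists>E R B. kernel_split (A_as (cycle_digraph n)) n 2 E R B"
proof -
  define A where "A = mat n n (\<lambda>(i, k). cycle_entry n i k)"
  \<comment> \<open>Column \<open>c\<close> is the indicator of the parity class \<open>c\<close>.
    \<open>R\<close> reads the entries 0 and 1, one from each class.\<close>
  define E where "E = mat n 2 (\<lambda>(j, c). of_bool (c = j mod 2) :: complex)"
  define R where "R = mat 2 n (\<lambda>(c, k). of_bool (k = c) :: complex)"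
  define B where "B = mat n n (\<lambda>(j, i). of_bool (0 < i \<and> i < j \<and> odd (i + j)) :: complex)"
  have "R * E = 1\<^sub>m 2"
    unfolding R_def E_def mat_times_mat one_mat_def
  proof (intro cong_mat refl, unfold prod.case)
    fix c c' :: nat assume c: "c < 2" "c' < 2"
    have "(\<Sum>k<n. of_bool (k = c) * of_bool (c' = k mod 2)) = (of_bool (c' = c mod 2) :: complex)"
      by (rule sum_of_bool_eq_mult) (use c assms in linarith)
    also have "\<dots> = (if c = c' then 1 else 0)" using c by auto
    finally show "(\<Sum>k<n. of_bool (k = c) * of_bool (c' = k mod 2))
        = (if c = c' then 1 else (0 :: complex))" .
  qed
  moreover have "A * E = 0\<^sub>m n 2"
    unfolding A_def E_def mat_times_mat zero_mat_def
  proof (intro cong_mat refl, unfold prod.case)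
    fix i c :: nat assume i: "i < n" and c: "c < 2"
    have "(if Suc i < n then of_bool (c = Suc i mod 2) else 0)
          - (if i = 0 then 0 else of_bool (c = (i - 1) mod 2))
          - (if i = 0 then of_bool (c = (n - 1) mod 2) else 0)
          + (if Suc i = n then of_bool (c = 0 mod 2) else 0) = (0 :: complex)"
    proof (cases i)
      case 0
      \<comment> \<open>The cyclic neighbours of 0 are 1 and \<open>n - 1\<close>, which have the
        same parity because \<open>n\<close> is even.\<close>
      have "odd (n - 1)" using assms by simp
      then have "(n - 1) mod 2 = Suc 0" unfolding odd_iff_mod_2_eq_one by simp
      then show ?thesis using 0 assms by simp
    next
      case (Suc m)
      \<comment> \<open>Here \<open>i\<close> is the last index: its neighbours are
        \<open>n - 2\<close> and 0, both even.\<close>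
      have "m mod 2 = 0" if "Suc (Suc m) = n"
        using that assms(1) by auto
      then show ?thesis using Suc i by (cases "Suc (Suc m) = n") simp_all
    qed
    then show "(\<Sum>k<n. cycle_entry n i k * of_bool (c = k mod 2)) = 0"
      unfolding sum_cycle_entry_right[OF i] sum_path_entry_right[OF i] .
  qed
  moreover have "E * R + B * A = 1\<^sub>m n"
    unfolding A_def B_def E_def R_def mat_times_mat mat_plus_mat one_mat_def
  proof (intro cong_mat refl, unfold prod.case)
    fix j k assume jk: "j < n" "k < n"
    have "(\<Sum>c<2. of_bool (c = j mod 2) * of_bool (k = c)) = (of_bool (k = j mod 2) :: complex)"
      by (rule sum_of_bool_eq_mult) simp
    moreover have "of_bool (k = j mod 2)
        + ((if k = 0 then 0 else of_bool (0 < k - 1 \<and> k - 1 < j \<and> odd (k - 1 + j)))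
        - (if Suc k < n then of_bool (0 < Suc k \<and> Suc k < j \<and> odd (Suc k + j)) else 0)
        + (if k = 0 then of_bool (0 < n - 1 \<and> n - 1 < j \<and> odd (n - 1 + j)) else 0)
        - (if Suc k = n then of_bool (0 < (0::nat) \<and> 0 < j \<and> odd (0 + j)) else 0))
        = (of_bool (j = k) :: complex)"
    proof -
      have nj: "\<not> n - 1 < j" using jk by simp
      have p: "j mod 2 = (if even j then 0 else Suc 0)" by (simp add: mod2_eq_if)
      \<comment> \<open>Columns 0 and 1 hold the starting values, supplied by \<open>E * R\<close>;
        from column 2 on the indicators telescope as for the path.\<close>
      consider "k = 0" | "k = Suc 0" | m where "k = Suc (Suc m)" by (metis not0_implies_Suc)
      then have "of_bool (k = (if even j then 0 else Suc 0))
        + ((if k = 0 then 0 else of_bool (0 < k - 1 \<and> k - 1 < j \<and> odd (k - 1 + j)))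
        - (if Suc k < n then of_bool (0 < Suc k \<and> Suc k < j \<and> odd (Suc k + j)) else 0)
        + (if k = 0 then of_bool (0 < n - 1 \<and> n - 1 < j \<and> odd (n - 1 + j)) else 0)
        - (if Suc k = n then of_bool (0 < (0::nat) \<and> 0 < j \<and> odd (0 + j)) else 0))
        = (of_bool (j = k) :: complex)"
      proof cases
        case 1
        consider "j = 0" | "j = 1" | "1 < j" by linarith
        then show ?thesis using jk nj 1 by cases simp_all
      next
        case 2
        consider "j = 0" | "j = 1" | "j = 2" | "2 < j" by linarith
        then show ?thesis using jk 2 by cases simp_all
      next
        case 3
        consider "j < k" | "j = k" | "j = Suc k" | "Suc k < j" by linarith
        then show ?thesis using jk 3 by cases simp_all
      qed
      then show ?thesis unfolding p .
    qed
    ultimately show "(\<Sum>c<2. of_bool (c = j mod 2) * of_bool (k = c))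
        + (\<Sum>i<n. of_bool (0 < i \<and> i < j \<and> odd (i + j)) * cycle_entry n i k)
        = (if j = k then 1 else (0 :: complex))"
      unfolding sum_cycle_entry_left[OF jk(2)] sum_path_entry_left[OF jk(2)] by simp
  qed
  ultimately have "kernel_split A n 2 E R B"
    by (simp add: kernel_split_def A_def E_def R_def B_def)
  then show ?thesis unfolding A_as_cycle[OF assms(2)] A_def by blast
qed

lemma star_sym_A_as_path: "star_sym (- 1) (A_as (path_digraph n))"
  unfolding star_sym_def A_as_path by (auto simp: path_entry_def)

lemma star_sym_A_as_cycle: "n \<ge> 3 \<Longrightarrow> star_sym (- 1) (A_as (cycle_digraph n))"
  unfolding star_sym_def by (auto simp: A_as_cycle path_entry_def cycle_entry_def)

section \<open>Betti numbers of paths and cycles\<close>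

lemma beta0_connected:
  assumes "nverts G \<ge> 1" "edges (path_digraph (nverts G)) \<subseteq> edges G"
    and "edges G \<subseteq> {1..nverts G} \<times> {1..nverts G}"
  shows "beta0 G = 1"
proof -
  let ?n = "nverts G" and ?r = "conn_rel G"
  have sym: "sym ?r" unfolding conn_rel_def by (intro sym_rtrancl) (auto simp: sym_def)
  have trans: "trans ?r" unfolding conn_rel_def by (rule trans_rtrancl)
  have from1: "(1, x) \<in> ?r" if "1 \<le> x" "x \<le> ?n" for x
    using that
  proof (induction x rule: dec_induct)
    case base
    then show ?case by (simp add: conn_rel_def)
  next
    case (step x)
    then have "(x, Suc x) \<in> edges G" using assms(2) by (auto simp: edges_path)
    then have "(x, Suc x) \<in> edges G \<union> (edges G)\<inverse>" by simp
    with step show ?case unfolding conn_rel_def by (metis Suc_leD rtrancl_into_rtrancl)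
  qed
  \<comment> \<open>\<open>conn_rel\<close> is a relation on all natural numbers, so a class has to
    be shown not to leave the vertex set.\<close>
  have closed: "y \<in> {1..?n}" if "(x, y) \<in> ?r" "x \<in> {1..?n}" for x y
    using that unfolding conn_rel_def by (induction rule: rtrancl_induct) (use assms(3) in auto)
  have "?r `` {x} = {1..?n}" if x: "x \<in> {1..?n}" for x
  proof (intro equalityI subsetI)
    fix y assume "y \<in> {1..?n}"
    then have "(x, 1) \<in> ?r" "(1, y) \<in> ?r" using from1 x symD[OF sym] by auto
    then show "y \<in> ?r `` {x}" using transD[OF trans] by auto
  qed (use closed x in auto)
  then have "{1..?n} // ?r = {{1..?n}}" using assms(1) by (auto simp: quotient_def)
  then show ?thesis by (simp add: beta0_def)
qed

lemma edges_path_image: "edges (path_digraph n) = (\<lambda>i. (i, i + 1)) ` {1..n - 1}"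
  by (auto simp: edges_path)

lemma card_edges_path: "card (edges (path_digraph n)) = n - 1"
  unfolding edges_path_image by (subst card_image) (auto simp: inj_on_def)

lemma betti_path:
  assumes "n \<ge> 2"
  shows "int (beta0 (path_digraph n)) + beta1 (path_digraph n) = 1"
proof -
  have "beta0 (path_digraph n) = 1"
    by (rule beta0_connected) (use assms in \<open>auto simp: edges_path\<close>)
  then show ?thesis using assms by (simp add: beta1_def card_edges_path)
qed

lemma betti_cycle:
  assumes "n \<ge> 3"
  shows "int (beta0 (cycle_digraph n)) + beta1 (cycle_digraph n) = 2"
proof -
  have "beta0 (cycle_digraph n) = 1"
    by (rule beta0_connected) (use assms in \<open>auto simp: edges_cycle edges_path\<close>)
  moreover have "card (edges (cycle_digraph n)) = Suc (n - 1)"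
    unfolding edges_cycle using assms card_edges_path[of n]
    by (subst card_insert_disjoint) (auto simp: edges_path_image)
  ultimately show ?thesis using assms by (simp add: beta1_def)
qed

text \<open>The closing edge ends in vertex 1, whereas path edges end in vertices at least 2. Since
  \<open>d\<close> counts the factors that equal some cycle, this keeps paths out of the
  count.\<close>

lemma path_neq_cycle:
  assumes "n \<ge> 2"
  shows "path_digraph n \<noteq> cycle_digraph m"
proof
  assume eq: "path_digraph n = cycle_digraph m"
  then have "n = m" by (metis nverts_path nverts_cycle)
  have "(m, 1) \<in> edges (cycle_digraph m)" unfolding edges_cycle by simp
  then have "(n, 1) \<in> edges (path_digraph n)" using eq \<open>n = m\<close> by simp
  then show False using assms by (auto simp: edges_path)
qed

subsection \<open>Cartesian products\<close>

lemma prod_list_map_delta: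
  fixes c :: "'b::comm_monoid_mult"
  assumes "distinct L" "\<mu> \<in> set L"
  shows "prod_list (map (\<lambda>\<nu>. if \<nu> = \<mu> then c else 1) L) = c"
  using assms by (simp add: prod.distinct_set_conv_list[symmetric])

text \<open>\<open>L\<close> orders the tensor factors and \<open>I\<close> the summands; they are
  kept apart because the operator lists its factors in reverse but sums in increasing order.
  \<open>slot\<close> puts a matrix in position \<open>\<mu>\<close> and identities
  elsewhere.\<close>

lemma rank_sum_kron:
  fixes A E R B \<gamma> :: "nat \<Rightarrow> complex mat" and n k :: "nat \<Rightarrow> nat"
  defines "slot \<equiv> \<lambda>X \<mu> \<nu>. if \<nu> = \<mu> then X \<nu> else 1\<^sub>m (n \<nu>)"
  assumes L: "distinct L" and I: "distinct I" "set I = set L"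
    and split: "\<And>\<nu>. \<nu> \<in> set L \<Longrightarrow> kernel_split (A \<nu>) (n \<nu>) (k \<nu>) (E \<nu>) (R \<nu>) (B \<nu>)"
    and skew: "\<And>\<nu>. \<nu> \<in> set L \<Longrightarrow> star_sym (- 1) (A \<nu>)"
    and \<gamma>: "\<And>\<nu>. \<nu> \<in> set L \<Longrightarrow> \<gamma> \<nu> \<in> carrier_mat r r"
    and \<gamma>_sq: "\<And>\<nu>. \<nu> \<in> set L \<Longrightarrow> \<gamma> \<nu> * \<gamma> \<nu> = 1\<^sub>m r"
    and \<gamma>_anti: "\<And>\<mu> \<nu>. \<mu> \<in> set L \<Longrightarrow> \<nu> \<in> set L \<Longrightarrow> \<mu> \<noteq> \<nu> \<Longrightarrow>
      \<gamma> \<mu> * \<gamma> \<nu> + \<gamma> \<nu> * \<gamma> \<mu> = 0\<^sub>m r r"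
    and N: "N = prod_list (map n L) * r"
  shows "mat_rank
      (foldr (+) (map (\<lambda>\<mu>. kron (kron_list (map (slot A \<mu>) L)) (\<gamma> \<mu>)) I) (0\<^sub>m N N))
    + prod_list (map k L) * r = N"
proof -
  let ?n = "prod_list (map n L)" and ?k = "prod_list (map k L)"
  define T where "T X \<mu> = kron_list (map (slot X \<mu>) L)" for X \<mu>
  define M where "M \<mu> = kron (T A \<mu>) (\<gamma> \<mu>)" for \<mu>
  \<comment> \<open>\<open>X \<mu>\<close> has the same square as \<open>M \<mu>\<close>, since
    \<open>\<gamma> \<mu>\<close> squares to 1, and is skew-Hermitian whatever
    \<open>\<gamma> \<mu>\<close> is.\<close>
  define X where "X \<mu> = kron (T A \<mu>) (1\<^sub>m r)" for \<mu>
  define EE where "EE = kron (kron_list (map E L)) (1\<^sub>m r)"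
  define RR where "RR = kron (kron_list (map R L)) (1\<^sub>m r)"
  define F where "F \<nu> = E \<nu> * R \<nu>" for \<nu>

  have A: "A \<nu> \<in> carrier_mat (n \<nu>) (n \<nu>)" and E: "E \<nu> \<in> carrier_mat (n \<nu>) (k \<nu>)"
    and R: "R \<nu> \<in> carrier_mat (k \<nu>) (n \<nu>)" and B: "B \<nu> \<in> carrier_mat (n \<nu>) (n \<nu>)"
    and RE: "R \<nu> * E \<nu> = 1\<^sub>m (k \<nu>)" and AE: "A \<nu> * E \<nu> = 0\<^sub>m (n \<nu>) (k \<nu>)"
    and FBA: "F \<nu> + B \<nu> * A \<nu> = 1\<^sub>m (n \<nu>)" if "\<nu> \<in> set L" for \<nu>
    using split[OF that] by (auto simp: kernel_split_def F_def)
  have F: "F \<nu> \<in> carrier_mat (n \<nu>) (n \<nu>)" if "\<nu> \<in> set L" for \<nu>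
    unfolding F_def using E[OF that] R[OF that] by (rule mult_carrier_mat)
  have slot: "slot Y \<mu> \<nu> \<in> carrier_mat (n \<nu>) (n \<nu>)"
    if "\<nu> \<in> set L" "\<And>\<nu>. \<nu> \<in> set L \<Longrightarrow> Y \<nu> \<in> carrier_mat (n \<nu>) (n \<nu>)" for Y \<mu> \<nu>
    using that(1) that(2)[of \<mu>] by (auto simp: slot_def)
  have T: "T Y \<mu> \<in> carrier_mat ?n ?n"
    if "\<And>\<nu>. \<nu> \<in> set L \<Longrightarrow> Y \<nu> \<in> carrier_mat (n \<nu>) (n \<nu>)" for Y \<mu>
    unfolding T_def by (rule kron_list_map_carrier) (rule slot[OF _ that])
  have M: "M \<mu> \<in> carrier_mat N N" if "\<mu> \<in> set L" for \<mu>
    unfolding M_def N by (rule kron_carrier[OF T[OF A] \<gamma>[OF that]])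
  have X: "X \<mu> \<in> carrier_mat N N" for \<mu>
    unfolding X_def N by (rule kron_carrier[OF T[OF A] one_carrier_mat])
  have EL: "kron_list (map E L) \<in> carrier_mat ?n ?k" by (rule kron_list_map_carrier[OF E])
  have RL: "kron_list (map R L) \<in> carrier_mat ?k ?n" by (rule kron_list_map_carrier[OF R])
  have EE: "EE \<in> carrier_mat N (?k * r)"
    unfolding EE_def N by (rule kron_carrier[OF EL one_carrier_mat])
  have RR: "RR \<in> carrier_mat (?k * r) N"
    unfolding RR_def N by (rule kron_carrier[OF RL one_carrier_mat])

  have RE_list: "kron_list (map R L) * kron_list (map E L) = 1\<^sub>m ?k"
  proof -
    have "kron_list (map R L) * kron_list (map E L) = kron_list (map (\<lambda>\<nu>. R \<nu> * E \<nu>) L)"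
      using R E by (intro kron_list_map_mult) (metis carrier_matD)
    also have "map (\<lambda>\<nu>. R \<nu> * E \<nu>) L = map (\<lambda>\<nu>. 1\<^sub>m (k \<nu>)) L" using RE by simp
    finally show ?thesis by (simp only: kron_list_map_one)
  qed
  have RR_EE: "RR * EE = 1\<^sub>m (?k * r)"
  proof -
    have "RR * EE = kron (kron_list (map R L) * kron_list (map E L)) (1\<^sub>m r * 1\<^sub>m r)"
      unfolding RR_def EE_def
      using carrier_matD[OF EL] carrier_matD[OF RL]
      by (intro kron_mult) (simp_all del: dim_kron_list)
    then show ?thesis by (simp add: RE_list kron_one)
  qed
  have EE_RR: "EE * RR = kron (kron_list (map F L)) (1\<^sub>m r)"
  proof -
    have "kron_list (map E L) * kron_list (map R L) = kron_list (map F L)"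
      unfolding F_def using R E by (intro kron_list_map_mult) (metis carrier_matD)
    moreover have "EE * RR = kron (kron_list (map E L) * kron_list (map R L)) (1\<^sub>m r * 1\<^sub>m r)"
      unfolding RR_def EE_def
      using carrier_matD[OF EL] carrier_matD[OF RL]
      by (intro kron_mult) (simp_all del: dim_kron_list)
    ultimately show ?thesis by simp
  qed

  have M_EE: "M \<mu> * EE = 0\<^sub>m N (?k * r)" if \<mu>: "\<mu> \<in> set L" for \<mu>
  proof -
    have "T A \<mu> * kron_list (map E L) = kron_list (map (\<lambda>\<nu>. slot A \<mu> \<nu> * E \<nu>) L)"
      unfolding T_def using slot[OF _ A] E by (intro kron_list_map_mult) (metis carrier_matD)
    also have "\<dots> = 0\<^sub>m ?n ?k"
    proof (rule kron_list_map_zero[OF _ \<mu>])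
      show "slot A \<mu> \<nu> * E \<nu> \<in> carrier_mat (n \<nu>) (k \<nu>)" if "\<nu> \<in> set L" for \<nu>
        using slot[OF that A] E[OF that] by (rule mult_carrier_mat)
      show "slot A \<mu> \<mu> * E \<mu> = 0\<^sub>m (n \<mu>) (k \<mu>)" using AE[OF \<mu>] by (simp add: slot_def)
    qed
    finally have *: "T A \<mu> * kron_list (map E L) = 0\<^sub>m ?n ?k" .
    have "M \<mu> * EE = kron (T A \<mu> * kron_list (map E L)) (\<gamma> \<mu> * 1\<^sub>m r)"
      unfolding M_def EE_def
      using carrier_matD[OF T[OF A]] carrier_matD[OF EL] carrier_matD[OF \<gamma>[OF \<mu>]]
      by (intro kron_mult) (simp_all del: dim_kron_list)
    also have "\<dots> = 0\<^sub>m N (?k * r)"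
      unfolding * kron_zero_left using carrier_matD[OF \<gamma>[OF \<mu>]] N by simp
    finally show ?thesis .
  qed

  have T_comm: "T A \<mu> * T A \<nu> = T A \<nu> * T A \<mu>" if "\<mu> \<noteq> \<nu>" for \<mu> \<nu>
  proof -
    have mult: "T A \<mu> * T A \<nu> = kron_list (map (\<lambda>\<kappa>. slot A \<mu> \<kappa> * slot A \<nu> \<kappa>) L)" for \<mu> \<nu>
      unfolding T_def using slot[OF _ A] by (intro kron_list_map_mult) (metis carrier_matD)
    \<comment> \<open>As \<open>\<mu> \<noteq> \<nu>\<close>, in each slot at least one of the two
      factors is an identity matrix.\<close>
    have "map (\<lambda>\<kappa>. slot A \<mu> \<kappa> * slot A \<nu> \<kappa>) L = map (\<lambda>\<kappa>. slot A \<nu> \<kappa> * slot A \<mu> \<kappa>) L"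
    proof (rule map_cong[OF refl])
      fix \<kappa> assume "\<kappa> \<in> set L"
      then show "slot A \<mu> \<kappa> * slot A \<nu> \<kappa> = slot A \<nu> \<kappa> * slot A \<mu> \<kappa>"
        using that A[of \<kappa>] by (auto simp: slot_def)
    qed
    then show ?thesis by (simp only: mult)
  qed
  have M_mult: "M \<mu> * M \<nu> = kron (T A \<mu> * T A \<nu>) (\<gamma> \<mu> * \<gamma> \<nu>)" if "\<mu> \<in> set L" "\<nu> \<in> set L" for \<mu> \<nu>
    unfolding M_def using carrier_matD[OF T[OF A]] \<gamma>[OF that(1)] \<gamma>[OF that(2)]
    by (intro kron_mult) simp_all
  have M_anti: "M \<mu> * M \<nu> + M \<nu> * M \<mu> = 0\<^sub>m N N"
    if "\<mu> \<in> set L" "\<nu> \<in> set L" "\<mu> \<noteq> \<nu>" for \<mu> \<nu>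
  proof -
    have "M \<mu> * M \<nu> + M \<nu> * M \<mu>
        = kron (T A \<mu> * T A \<nu>) (\<gamma> \<mu> * \<gamma> \<nu>) + kron (T A \<mu> * T A \<nu>) (\<gamma> \<nu> * \<gamma> \<mu>)"
      unfolding M_mult[OF that(1,2)] M_mult[OF that(2,1)] T_comm[OF that(3)] ..
    also have "\<dots> = kron (T A \<mu> * T A \<nu>) (\<gamma> \<mu> * \<gamma> \<nu> + \<gamma> \<nu> * \<gamma> \<mu>)"
      by (rule kron_add_right[symmetric, OF mult_carrier_mat mult_carrier_mat])
         (use \<gamma> that in blast)+
    also have "\<dots> = 0\<^sub>m N N"
      unfolding \<gamma>_anti[OF that] kron_zero_right using carrier_matD[OF T[OF A]] N by simp
    finally show ?thesis .
  qed
  have M_sq: "M \<mu> * M \<mu> = X \<mu> * X \<mu>" if "\<mu> \<in> set L" for \<mu>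
  proof -
    have "X \<mu> * X \<mu> = kron (T A \<mu> * T A \<mu>) (1\<^sub>m r * 1\<^sub>m r)"
      unfolding X_def using carrier_matD[OF T[OF A]] by (intro kron_mult) simp_all
    then show ?thesis using M_mult[OF that that] \<gamma>_sq[OF that] by simp
  qed
  have X_skew: "star_sym (- 1) (X \<mu>)" if \<mu>: "\<mu> \<in> set L" for \<mu>
  proof -
    \<comment> \<open>Only slot \<open>\<mu>\<close> contributes the sign -1; the identities
      contribute 1.\<close>
    have "star_sym (prod_list (map (\<lambda>\<nu>. if \<nu> = \<mu> then - 1 else 1) L)) (T A \<mu>)"
      unfolding T_def
      by (rule star_sym_kron_list_map) (use skew star_sym_one in \<open>auto simp: slot_def\<close>)
    then have "star_sym (- 1) (T A \<mu>)" unfolding prod_list_map_delta[OF L \<mu>] .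
    from star_sym_kron[OF this star_sym_one] show ?thesis by (simp add: X_def)
  qed

  let ?D = "foldr (+) (map M I) (0\<^sub>m N N)"
  have MI: "M \<mu> \<in> carrier_mat N N" if "\<mu> \<in> set I" for \<mu> using M that I by simp
  have D: "?D \<in> carrier_mat N N" by (rule foldr_add_mat_carrier[OF MI])

  have mult_zero: "Y *\<^sub>v 0\<^sub>v m = 0\<^sub>v m" if "Y \<in> carrier_mat m m" for Y :: "complex mat" and m
    using that by auto
  have X_zero: "X \<mu> *\<^sub>v v = 0\<^sub>v N"
    if v: "v \<in> carrier_vec N" and Dv: "?D *\<^sub>v v = 0\<^sub>v N" and \<mu>: "\<mu> \<in> set L" for v \<mu>
  proof -
    have "(?D * ?D) *\<^sub>v v = ?D *\<^sub>v (?D *\<^sub>v v)" by (rule assoc_mult_mat_vec[OF D D v])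
    also have "\<dots> = 0\<^sub>v N" unfolding Dv by (rule mult_zero[OF D])
    finally have "(?D * ?D) *\<^sub>v v = 0\<^sub>v N" .
    moreover have "?D * ?D = foldr (+) (map (\<lambda>\<mu>. M \<mu> * M \<mu>) I) (0\<^sub>m N N)"
      by (rule foldr_add_mat_square[OF MI I(1)]) (use M_anti I in auto)
    moreover have "map (\<lambda>\<mu>. M \<mu> * M \<mu>) I = map (\<lambda>\<mu>. X \<mu> * X \<mu>) I" using M_sq I by simp
    ultimately have "(foldr (+) (map (\<lambda>\<mu>. X \<mu> * X \<mu>) I) (0\<^sub>m N N) *\<^sub>v v) \<bullet>c v = 0\<^sub>v N \<bullet>c v"
      by (simp only:)
    also have "\<dots> = 0" using v by (intro scalar_prod_left_zero) simp
    finally have "(\<Sum>\<mu>\<leftarrow>I. ((X \<mu> * X \<mu>) *\<^sub>v v) \<bullet>c v) = 0"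
      using foldr_add_mat_scalar_prod[of I "\<lambda>\<mu>. X \<mu> * X \<mu>" N v "conjugate v"]
        mult_carrier_mat[OF X X] v by simp
    also have "map (\<lambda>\<mu>. ((X \<mu> * X \<mu>) *\<^sub>v v) \<bullet>c v) I
        = map (\<lambda>\<mu>. - ((X \<mu> *\<^sub>v v) \<bullet>c (X \<mu> *\<^sub>v v))) I"
      by (rule map_cong[OF refl], rule star_sym_square_scalar_prod[OF X X_skew v]) (use I in simp)
    finally have "(\<Sum>\<mu>\<leftarrow>I. (X \<mu> *\<^sub>v v) \<bullet>c (X \<mu> *\<^sub>v v)) = 0"
      by (simp add: uminus_sum_list_map[symmetric, unfolded o_def])
    \<comment> \<open>In the order on \<open>complex\<close>, \<open>0 \<le> z\<close> means real
      and nonnegative, so a vanishing sum of such terms forces every term to vanish.\<close>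
    moreover have "0 \<le> (X \<mu> *\<^sub>v v) \<bullet>c (X \<mu> *\<^sub>v v)" for \<mu> by (rule conjugate_square_ge_0_vec)
    ultimately have "(X \<mu> *\<^sub>v v) \<bullet>c (X \<mu> *\<^sub>v v) = 0"
      using \<mu> I(2) by (subst (asm) sum_list_nonneg_eq_0_iff) auto
    then show ?thesis using conjugate_square_eq_0_vec[OF mult_mat_vec_carrier[OF X v]] by simp
  qed

  have slot_F_fix: "kron (T F \<mu>) (1\<^sub>m r) *\<^sub>v v = v"
    if v: "v \<in> carrier_vec N" and Xv: "X \<mu> *\<^sub>v v = 0\<^sub>v N" and \<mu>: "\<mu> \<in> set L" for v \<mu>
  proof -
    \<comment> \<open>The identity splits in slot \<open>\<mu>\<close> as
      \<open>F \<mu> + BA \<mu>\<close>; the second part factors through \<open>X \<mu>\<close> and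
      so annihilates \<open>v\<close>.\<close>
    define BA where "BA \<nu> = B \<nu> * A \<nu>" for \<nu>
    have BA: "BA \<nu> \<in> carrier_mat (n \<nu>) (n \<nu>)" if "\<nu> \<in> set L" for \<nu>
      unfolding BA_def using B[OF that] A[OF that] by (rule mult_carrier_mat)
    have "T B \<mu> * T A \<mu> = kron_list (map (\<lambda>\<nu>. slot B \<mu> \<nu> * slot A \<mu> \<nu>) L)"
      unfolding T_def using slot[OF _ A] slot[OF _ B]
      by (intro kron_list_map_mult) (metis carrier_matD)
    also have "map (\<lambda>\<nu>. slot B \<mu> \<nu> * slot A \<mu> \<nu>) L = map (slot BA \<mu>) L"
      by (rule map_cong[OF refl]) (simp add: slot_def BA_def)
    finally have TBA: "T BA \<mu> = T B \<mu> * T A \<mu>" unfolding T_def ..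
    have "kron (T BA \<mu>) (1\<^sub>m r) = kron (T B \<mu>) (1\<^sub>m r) * X \<mu>"
      unfolding TBA X_def using carrier_matD[OF T[OF A]] carrier_matD[OF T[OF B]]
      by (subst kron_mult) simp_all
    then have "kron (T BA \<mu>) (1\<^sub>m r) *\<^sub>v v = kron (T B \<mu>) (1\<^sub>m r) *\<^sub>v (X \<mu> *\<^sub>v v)"
      using assoc_mult_mat_vec[OF kron_carrier[OF T[OF B] one_carrier_mat] X[unfolded N] v[unfolded N]]
      by simp
    also have "\<dots> = 0\<^sub>v N"
      unfolding Xv N by (rule mult_zero[OF kron_carrier[OF T[OF B] one_carrier_mat]])
    finally have BAv: "kron (T BA \<mu>) (1\<^sub>m r) *\<^sub>v v = 0\<^sub>v N" .
    have "kron_list (map (\<lambda>\<nu>. 1\<^sub>m (n \<nu>)) L) = T F \<mu> + T BA \<mu>"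
      unfolding T_def
      by (rule kron_list_map_add[OF slot[OF _ F] slot[OF _ BA] \<mu> L])
         (use FBA[OF \<mu>] in \<open>auto simp: slot_def BA_def\<close>)
    then have "1\<^sub>m N = kron (T F \<mu> + T BA \<mu>) (1\<^sub>m r)"
      unfolding kron_list_map_one N by (metis kron_one)
    also have "\<dots> = kron (T F \<mu>) (1\<^sub>m r) + kron (T BA \<mu>) (1\<^sub>m r)"
      by (rule kron_add_left[OF T[OF F] T[OF BA]])
    finally have "1\<^sub>m N *\<^sub>v v = (kron (T F \<mu>) (1\<^sub>m r) + kron (T BA \<mu>) (1\<^sub>m r)) *\<^sub>v v" by simp
    also have "\<dots> = kron (T F \<mu>) (1\<^sub>m r) *\<^sub>v v + kron (T BA \<mu>) (1\<^sub>m r) *\<^sub>v v"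
      by (rule add_mult_distrib_mat_vec[OF kron_carrier[OF T[OF F] one_carrier_mat]
            kron_carrier[OF T[OF BA] one_carrier_mat] v[unfolded N]])
    also have "\<dots> = kron (T F \<mu>) (1\<^sub>m r) *\<^sub>v v"
      unfolding BAv
      using mult_mat_vec_carrier[OF kron_carrier[OF T[OF F] one_carrier_mat] v[unfolded N]] N by simp
    finally show ?thesis using v by simp
  qed

  have "(EE * RR) *\<^sub>v v = v" if v: "v \<in> carrier_vec N" and Dv: "?D *\<^sub>v v = 0\<^sub>v N" for v
  proof -
    \<comment> \<open>\<open>G S\<close> has the kernel projections in the slots of \<open>S\<close>
      and identities elsewhere. Growing \<open>S\<close> from the empty set to \<open>set L\<close>
      turns the identity into \<open>EE * RR\<close>, and \<open>v\<close> stays fixed at each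
      step.\<close>
    define G where "G S \<nu> = (if \<nu> \<in> S then F \<nu> else 1\<^sub>m (n \<nu>))" for S \<nu>
    have G: "G S \<nu> \<in> carrier_mat (n \<nu>) (n \<nu>)" if "\<nu> \<in> set L" for S \<nu>
      using F[OF that] by (simp add: G_def)
    have GL: "kron_list (map (G S) L) \<in> carrier_mat ?n ?n" for S
      by (rule kron_list_map_carrier[OF G])
    have "kron (kron_list (map (G S) L)) (1\<^sub>m r) *\<^sub>v v = v" if "finite S" "S \<subseteq> set L" for S
      using that
    proof (induction S rule: finite_induct)
      case empty
      then show ?case using v by (simp add: G_def kron_list_map_one kron_one N)
    next
      case (insert \<mu> S)
      have "kron_list (map (G S) L) * T F \<mu> = kron_list (map (\<lambda>\<nu>. G S \<nu> * slot F \<mu> \<nu>) L)"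
        unfolding T_def using slot[OF _ F] G by (intro kron_list_map_mult) (metis carrier_matD)
      \<comment> \<open>Because \<open>\<mu>\<close> is not in \<open>S\<close>, \<open>G S\<close>
        has an identity in slot \<open>\<mu>\<close>, and the product merely fills that
        slot.\<close>
      also have "map (\<lambda>\<nu>. G S \<nu> * slot F \<mu> \<nu>) L = map (G (insert \<mu> S)) L"
      proof (rule map_cong[OF refl])
        fix \<nu> assume "\<nu> \<in> set L"
        then show "G S \<nu> * slot F \<mu> \<nu> = G (insert \<mu> S) \<nu>"
          using insert.hyps F[of \<nu>] by (auto simp: G_def slot_def)
      qed
      finally have "kron (kron_list (map (G (insert \<mu> S)) L)) (1\<^sub>m r)
          = kron (kron_list (map (G S) L)) (1\<^sub>m r) * kron (T F \<mu>) (1\<^sub>m r)"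
        using carrier_matD[OF T[OF F]] carrier_matD[OF GL]
        by (subst kron_mult) (simp_all del: dim_kron_list)
      then have "kron (kron_list (map (G (insert \<mu> S)) L)) (1\<^sub>m r) *\<^sub>v v
          = kron (kron_list (map (G S) L)) (1\<^sub>m r) *\<^sub>v (kron (T F \<mu>) (1\<^sub>m r) *\<^sub>v v)"
        using assoc_mult_mat_vec[OF kron_carrier[OF GL one_carrier_mat]
            kron_carrier[OF T[OF F] one_carrier_mat] v[unfolded N]]
        by simp
      also have "\<dots> = v"
        using insert slot_F_fix[OF v X_zero[OF v Dv]] by simp
      finally show ?case .
    qed
    from this[OF finite_set subset_refl]
    have "kron (kron_list (map (G (set L)) L)) (1\<^sub>m r) *\<^sub>v v = v" .
    moreover have "map (G (set L)) L = map F L" by (rule map_cong[OF refl]) (simp add: G_def)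
    ultimately show ?thesis by (simp only: EE_RR)
  qed
  moreover have "?D * EE = 0\<^sub>m N (?k * r)"
    by (rule foldr_add_mat_mult_zero[OF MI EE M_EE]) (use I in auto)
  ultimately have "vec_space.rank N ?D + ?k * r = N"
    by (intro rank_plus_kernel_parametrization[OF D EE RR RR_EE])
  then have "mat_rank ?D + ?k * r = N" unfolding mat_rank_def carrier_matD(1)[OF D] .
  then show ?thesis unfolding M_def T_def .
qed

theorem theorem5:
  fixes Gs :: "digraph list" and gs :: "complex mat list" and r :: nat and d :: nat
  assumes D_pos: "length Gs \<ge> 1"
    and gs_len: "length gs = length Gs"
    and gs_dim: "\<forall>\<mu> < length gs. gs ! \<mu> \<in> carrier_mat r r"
    and clifford: "\<forall>\<mu> < length gs. \<forall>\<nu> < length gs.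
         gs ! \<mu> * gs ! \<nu> + gs ! \<nu> * gs ! \<mu> = (if \<mu> = \<nu> then 2 \<cdot>\<^sub>m 1\<^sub>m r else 0\<^sub>m r r)"
    and factors: "\<forall>\<mu> < length Gs.
         (\<exists>n. n \<ge> 3 \<and> even n \<and> Gs ! \<mu> = cycle_digraph n) \<or>
         (\<exists>n. n \<ge> 2 \<and> odd n \<and> Gs ! \<mu> = path_digraph n)"
    and d_def: "d = card {\<mu>. \<mu> < length Gs \<and> (\<exists>n. Gs ! \<mu> = cycle_digraph n)}"
  shows "int ((\<Prod>G\<leftarrow>Gs. nverts G) * r) - int (mat_rank (Dop Gs gs r))
           = int r * (\<Prod>G\<leftarrow>Gs. int (beta0 G) + beta1 G)
       \<and> int r * (\<Prod>G\<leftarrow>Gs. int (beta0 G) + beta1 G) = int r * 2 ^ d"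
proof -
  let ?m = "length Gs"
  define n where "n \<nu> = nverts (Gs ! \<nu>)" for \<nu>
  \<comment> \<open>\<open>k \<nu>\<close> is both the kernel dimension of the factor and its sum of
    Betti numbers. It uses the same test for cycles as \<open>d\<close>, so that its product is a
    power of 2 with exponent \<open>d\<close>.\<close>
  define k where "k \<nu> = (if \<exists>n. Gs ! \<nu> = cycle_digraph n then 2 else 1 :: nat)" for \<nu>
  define A where "A \<nu> = A_as (Gs ! \<nu>)" for \<nu>
  have factor: "(\<exists>E R B. kernel_split (A \<nu>) (n \<nu>) (k \<nu>) E R B) \<and> star_sym (- 1) (A \<nu>)
      \<and> int (beta0 (Gs ! \<nu>)) + beta1 (Gs ! \<nu>) = int (k \<nu>)" if "\<nu> < ?m" for \<nu>
  proof -
    from factors that consider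
        (cycle) c where "c \<ge> 3" "even c" "Gs ! \<nu> = cycle_digraph c"
      | (path) c where "c \<ge> 2" "odd c" "Gs ! \<nu> = path_digraph c" by blast
    then show ?thesis
    proof cases
      case cycle
      then have "k \<nu> = 2" by (auto simp: k_def)
      with cycle show ?thesis
        using kernel_split_cycle[of c] star_sym_A_as_cycle[of c] betti_cycle[of c]
        by (simp add: A_def n_def)
    next
      case path
      then have "k \<nu> = 1" using path_neq_cycle[of c] by (auto simp: k_def)
      with path show ?thesis
        using kernel_split_path[of c] star_sym_A_as_path[of c] betti_path[of c]
        by (simp add: A_def n_def)
    qed
  qed
  then obtain E R B where split:
    "\<And>\<nu>. \<nu> < ?m \<Longrightarrow> kernel_split (A \<nu>) (n \<nu>) (k \<nu>) (E \<nu>) (R \<nu>) (B \<nu>)"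
    by metis
  define I where "I = [0..<?m]"
  \<comment> \<open>The last graph is the leftmost Kronecker factor.\<close>
  define L where "L = rev I"
  define N where "N = prod_list (map n L) * r"
  have set_L: "set L = {..<?m}" and set_I: "set I = set L" by (auto simp: L_def I_def)
  have prod_L: "prod_list (map f L) = (\<Prod>G\<leftarrow>Gs. g G)"
    if "\<And>\<nu>. \<nu> < ?m \<Longrightarrow> f \<nu> = g (Gs ! \<nu>)" for f :: "nat \<Rightarrow> 'x::comm_monoid_mult" and g
  proof -
    have "prod_list (map f L) = prod_list (map f I)"
      unfolding L_def rev_map[symmetric] by (rule prod_list.rev)
    also have "map f I = map g Gs"
      by (rule nth_equalityI) (use that in \<open>auto simp: I_def\<close>)
    finally show ?thesis .
  qed
  have prod_n: "prod_list (map n L) = (\<Prod>G\<leftarrow>Gs. nverts G)" by (rule prod_L) (simp add: n_def)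
  \<comment> \<open>The diagonal Clifford relation only gives twice the square; the factor 2 is
    cancelled entry by entry.\<close>
  have sq: "gs ! \<nu> * gs ! \<nu> = 1\<^sub>m r" if "\<nu> < ?m" for \<nu>
  proof (rule eq_matI)
    have "gs ! \<nu> * gs ! \<nu> + gs ! \<nu> * gs ! \<nu> = 2 \<cdot>\<^sub>m 1\<^sub>m r" using clifford that gs_len by simp
    moreover have c: "gs ! \<nu> * gs ! \<nu> \<in> carrier_mat r r"
      using gs_dim that gs_len by (metis mult_carrier_mat)
    ultimately have "(gs ! \<nu> * gs ! \<nu>) $$ (i, j) + (gs ! \<nu> * gs ! \<nu>) $$ (i, j)
        = 2 * (1\<^sub>m r :: complex mat) $$ (i, j)" if "i < r" "j < r" for i j
      using that by (metis carrier_matD index_add_mat(1) index_smult_mat(1) index_one_mat(2,3))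
    then show "(gs ! \<nu> * gs ! \<nu>) $$ (i, j) = (1\<^sub>m r :: complex mat) $$ (i, j)"
      if "i < dim_row (1\<^sub>m r :: complex mat)" "j < dim_col (1\<^sub>m r :: complex mat)" for i j
      using that by (metis index_one_mat(2,3) mult_2 mult_left_cancel zero_neq_numeral)
    show "dim_row (gs ! \<nu> * gs ! \<nu>) = dim_row (1\<^sub>m r :: complex mat)"
      "dim_col (gs ! \<nu> * gs ! \<nu>) = dim_col (1\<^sub>m r :: complex mat)"
      using c by (simp_all del: index_mult_mat)
  qed
  have rank: "mat_rank
      (foldr (+) (map (\<lambda>\<mu>. kron (kron_list (map (\<lambda>\<nu>. if \<nu> = \<mu> then A \<nu> else 1\<^sub>m (n \<nu>)) L)) (gs ! \<mu>)) I)
        (0\<^sub>m N N)) + prod_list (map k L) * r = N"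
  proof (rule rank_sum_kron[of L I A n k E R B "(!) gs" r N])
    show "distinct L" "distinct I" by (simp_all add: L_def I_def)
  qed (use split factor sq clifford gs_dim gs_len in \<open>simp_all add: set_L set_I N_def\<close>)
  have Dop: "Dop Gs gs r = foldr (+) (map (\<lambda>\<mu>.
      kron (kron_list (map (\<lambda>\<nu>. if \<nu> = \<mu> then A \<nu> else 1\<^sub>m (n \<nu>)) L)) (gs ! \<mu>)) I) (0\<^sub>m N N)"
  proof -
    have N_eq: "r * (\<Prod>G\<leftarrow>Gs. nverts G) = N" by (simp add: N_def prod_n)
    show ?thesis unfolding Dop_def N_eq L_def I_def A_def n_def rev_map ..
  qed
  have "mat_rank (Dop Gs gs r) + prod_list (map k L) * r = N"
    unfolding Dop by (rule rank)
  then have "int N - int (mat_rank (Dop Gs gs r)) = int r * int (prod_list (map k L))"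
    by (metis add_diff_cancel_left' mult.commute of_nat_add of_nat_mult)
  moreover have "int (prod_list (map k L)) = (\<Prod>G\<leftarrow>Gs. int (beta0 G) + beta1 G)"
  proof -
    have "int (prod_list (map k L)) = prod_list (map (\<lambda>\<nu>. int (k \<nu>)) L)"
      by (induction L) auto
    also have "\<dots> = (\<Prod>G\<leftarrow>Gs. int (beta0 G) + beta1 G)"
      by (rule prod_L) (use factor in simp)
    finally show ?thesis .
  qed
  moreover have "prod_list (map k L) = 2 ^ d"
  proof -
    have "prod_list (map k L) = (\<Prod>\<nu><?m. k \<nu>)"
      using set_L by (subst prod.distinct_set_conv_list[symmetric]) (simp_all add: L_def I_def)
    also have "\<dots> = 2 ^ d"
      unfolding k_def d_def by (subst prod.If_cases) (simp_all add: Collect_conj_eq lessThan_def)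
    finally show ?thesis .
  qed
  ultimately show ?thesis unfolding N_def prod_n by simp
qed

end
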